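(* For any $\Gamma\cup\{\varphi\}\subseteq Fm_{\mathcal L}$: $\Gamma\vdash_{\mathbf{LV}}\varphi\Leftrightarrow\Gamma\models_{\mathsf{LTS},l}\varphi$.
   Context: $\mathcal L$ is the language $\{\land,\lor,\to,0,1\}$ expanded with a binary counterfactual connective $\mathbin{\Box\!\!\rightarrow}$. $\mathbf{LV}$ is the smallest finitary consequence relation containing classical axioms and (L1) $\varphi\mathbin{\Box\!\!\rightarrow}\varphi$, (L2) $((\varphi\mathbin{\Box\!\!\rightarrow}\psi)\wedge(\psi\mathbin{\Box\!\!\rightarrow}\varphi))\to((\varphi\mathbin{\Box\!\!\rightarrow}\gamma)\leftrightarrow(\psi\mathbin{\Box\!\!\rightarrow}\gamma))$, (L3) $((\varphi\vee\psi)\mathbin{\Box\!\!\rightarrow}\varphi)\vee((\varphi\vee\psi)\mathbin{\Box\!\!\rightarrow}\psi)\vee(((\varphi\vee\psi)\mathbin{\Box\!\!\rightarrow}\gamma)\leftrightarrow((\varphi\mathbin{\Box\!\!\rightarrow}\gamma)\wedge(\psi\mathbin{\Box\!\!\rightarrow}\gamma)))$, (L4) $(\varphi\mathbin{\Box\!\!\rightarrow}(\psi\land\gamma))\leftrightarrow((\varphi\mathbin{\Box\!\!\rightarrow}\psi)\land(\varphi\mathbin{\Box\!\!\rightarrow}\gamma))$, closed under modus ponens and: if $\vdash\varphi\to\psi$ then $\vdash(\gamma\mathbin{\Box\!\!\rightarrow}\varphi)\to(\gamma\mathbin{\Box\!\!\rightarrow}\psi)$. A topological sphere is $(S,\tau,\sigma)$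 with $(S,\tau)$ a Stone space and $\sigma(x)$ a nested family of subsets for each $x$, such that for clopens $A,B$: $\{x:A\cap\bigcap\{U\in\sigma(x):U\cap A\neq\emptyset\}\subseteq B\}$ is clopen; if $A\cap\bigcup\sigma(x)\neq\emptyset$ there is a smallest $U\in\sigma(x)$ meeting $A$ (limit assumption); and $A\cap\bigcap\{U\in\sigma(x):U\cap A\neq\emptyset\}$ is closed. $\mathsf{LTS}$ is the class of sphere models $(S,\sigma,v)$ from topological spheres with $v$ assigning variables to clopens, with $v(\varphi\mathbin{\Box\!\!\rightarrow}\psi)=\{w:\bigcup\sigma(w)\cap v(\varphi)=\emptyset$ or $\exists U\in\sigma(w)$ with $\emptyset\neq U\cap v(\varphi)\subseteq v(\psi)\}$ and Boolean connectives classical. $\Gamma\models_{\mathsf{LTS},l}\varphi$ iff for every model in $\mathsf{LTS}$ and every world $w$, if $w$ satisfies all of $\Gamma$ then $w$ satisfies $\varphi$. *)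

theory Defs
  imports "HOL-Analysis.Analysis"
begin

datatype 'v fm =
    Var 'v
  | Bot  ("\<^bold>0")
  | Top  ("\<^bold>1")
  | And "'v fm" "'v fm"  (infixr "\<^bold>\<and>" 45)
  | Or "'v fm" "'v fm"  (infixr "\<^bold>\<or>" 40)
  | Imp "'v fm" "'v fm"  (infixr "\<^bold>\<rightarrow>" 35)
  | Cf "'v fm" "'v fm"  (infix "\<box>\<rightarrow>" 50)

abbreviation Iff :: "'v fm \<Rightarrow> 'v fm \<Rightarrow> 'v fm"  (infix "\<^bold>\<leftrightarrow>" 34) where
  "\<phi> \<^bold>\<leftrightarrow> \<psi> \<equiv> (\<phi> \<^bold>\<rightarrow> \<psi>) \<^bold>\<and> (\<psi> \<^bold>\<rightarrow> \<phi>)"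

inductive LV_axiom :: "'v fm \<Rightarrow> bool" where
  K: "LV_axiom (\<phi> \<^bold>\<rightarrow> (\<psi> \<^bold>\<rightarrow> \<phi>))"
| S: "LV_axiom ((\<phi> \<^bold>\<rightarrow> (\<psi> \<^bold>\<rightarrow> \<gamma>)) \<^bold>\<rightarrow> ((\<phi> \<^bold>\<rightarrow> \<psi>) \<^bold>\<rightarrow> (\<phi> \<^bold>\<rightarrow> \<gamma>)))"
| AndE1: "LV_axiom ((\<phi> \<^bold>\<and> \<psi>) \<^bold>\<rightarrow> \<phi>)"
| AndE2: "LV_axiom ((\<phi> \<^bold>\<and> \<psi>) \<^bold>\<rightarrow> \<psi>)"
| AndI: "LV_axiom (\<phi> \<^bold>\<rightarrow> (\<psi> \<^bold>\<rightarrow> (\<phi> \<^bold>\<and> \<psi>)))"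
| OrI1: "LV_axiom (\<phi> \<^bold>\<rightarrow> (\<phi> \<^bold>\<or> \<psi>))"
| OrI2: "LV_axiom (\<psi> \<^bold>\<rightarrow> (\<phi> \<^bold>\<or> \<psi>))"
| OrE: "LV_axiom ((\<phi> \<^bold>\<rightarrow> \<gamma>) \<^bold>\<rightarrow> ((\<psi> \<^bold>\<rightarrow> \<gamma>) \<^bold>\<rightarrow> ((\<phi> \<^bold>\<or> \<psi>) \<^bold>\<rightarrow> \<gamma>)))"
| BotE: "LV_axiom (\<^bold>0 \<^bold>\<rightarrow> \<phi>)"
| TopI: "LV_axiom \<^bold>1"
| DNE: "LV_axiom (((\<phi> \<^bold>\<rightarrow> \<^bold>0) \<^bold>\<rightarrow> \<^bold>0) \<^bold>\<rightarrow> \<phi>)"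
| L1: "LV_axiom (\<phi> \<box>\<rightarrow> \<phi>)"
| L2: "LV_axiom (((\<phi> \<box>\<rightarrow> \<psi>) \<^bold>\<and> (\<psi> \<box>\<rightarrow> \<phi>)) \<^bold>\<rightarrow> ((\<phi> \<box>\<rightarrow> \<gamma>) \<^bold>\<leftrightarrow> (\<psi> \<box>\<rightarrow> \<gamma>)))"
| L3: "LV_axiom (((\<phi> \<^bold>\<or> \<psi>) \<box>\<rightarrow> \<phi>) \<^bold>\<or> ((\<phi> \<^bold>\<or> \<psi>) \<box>\<rightarrow> \<psi>) \<^bold>\<or>
    (((\<phi> \<^bold>\<or> \<psi>) \<box>\<rightarrow> \<gamma>) \<^bold>\<leftrightarrow> ((\<phi> \<box>\<rightarrow> \<gamma>) \<^bold>\<and> (\<psi> \<box>\<rightarrow> \<gamma>))))"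
| L4: "LV_axiom ((\<phi> \<box>\<rightarrow> (\<psi> \<^bold>\<and> \<gamma>)) \<^bold>\<leftrightarrow> ((\<phi> \<box>\<rightarrow> \<psi>) \<^bold>\<and> (\<phi> \<box>\<rightarrow> \<gamma>)))"

text \<open>The last rule applies to theorems only: its premise is derived from the empty set.
  The relation is a finitary consequence relation by the three lemmas that follow, and by
  induction it is contained in every consequence relation with the axioms and the rules.\<close>

inductive LV :: "'v fm set \<Rightarrow> 'v fm \<Rightarrow> bool"  (infix "\<turnstile>\<^sub>L\<^sub>V" 50) where
  Prem: "\<phi> \<in> \<Gamma> \<Longrightarrow> \<Gamma> \<turnstile>\<^sub>L\<^sub>V \<phi>"
| Ax: "LV_axiom \<phi> \<Longrightarrow> \<Gamma> \<turnstile>\<^sub>L\<^sub>V \<phi>"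
| MP: "\<Gamma> \<turnstile>\<^sub>L\<^sub>V \<phi> \<Longrightarrow> \<Gamma> \<turnstile>\<^sub>L\<^sub>V (\<phi> \<^bold>\<rightarrow> \<psi>) \<Longrightarrow> \<Gamma> \<turnstile>\<^sub>L\<^sub>V \<psi>"
| RCM: "{} \<turnstile>\<^sub>L\<^sub>V (\<phi> \<^bold>\<rightarrow> \<psi>) \<Longrightarrow> \<Gamma> \<turnstile>\<^sub>L\<^sub>V ((\<gamma> \<box>\<rightarrow> \<phi>) \<^bold>\<rightarrow> (\<gamma> \<box>\<rightarrow> \<psi>))"

lemma LV_mono: "\<Gamma> \<turnstile>\<^sub>L\<^sub>V \<phi> \<Longrightarrow> \<Gamma> \<subseteq> \<Delta> \<Longrightarrow> \<Delta> \<turnstile>\<^sub>L\<^sub>V \<phi>"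
proof (induction rule: LV.induct)
  case (MP \<Gamma> \<phi> \<psi>)
  show ?case by (rule LV.MP[OF MP.IH]) (use MP.prems in auto)
qed (auto intro: LV.Prem LV.Ax LV.RCM)

lemma LV_cut: "\<Delta> \<turnstile>\<^sub>L\<^sub>V \<phi> \<Longrightarrow> (\<And>\<psi>. \<psi> \<in> \<Delta> \<Longrightarrow> \<Gamma> \<turnstile>\<^sub>L\<^sub>V \<psi>) \<Longrightarrow> \<Gamma> \<turnstile>\<^sub>L\<^sub>V \<phi>"
proof (induction rule: LV.induct)
  case (MP \<Gamma> \<phi> \<psi>)
  show ?case by (rule LV.MP[OF MP.IH]) (use MP.prems in auto)
qed (auto intro: LV.Ax LV.RCM)

lemma LV_finitary: "\<Gamma> \<turnstile>\<^sub>L\<^sub>V \<phi> \<Longrightarrow> \<exists>\<Delta>. \<Delta> \<subseteq> \<Gamma> \<and> finite \<Delta> \<and> \<Delta> \<turnstile>\<^sub>L\<^sub>V \<phi>"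
proof (induction rule: LV.induct)
  case (Prem \<phi> \<Gamma>)
  then show ?case by (intro exI[of _ "{\<phi>}"]) (simp add: LV.Prem)
next
  case (Ax \<phi> \<Gamma>)
  then show ?case by (intro exI[of _ "{}"]) (simp add: LV.Ax)
next
  case (MP \<Gamma> \<phi> \<psi>)
  obtain \<Delta> where 1: "\<Delta> \<subseteq> \<Gamma>" "finite \<Delta>" "\<Delta> \<turnstile>\<^sub>L\<^sub>V \<phi>"
    using MP.IH(1) by (elim exE conjE)
  obtain \<Delta>' where 2: "\<Delta>' \<subseteq> \<Gamma>" "finite \<Delta>'" "\<Delta>' \<turnstile>\<^sub>L\<^sub>V (\<phi> \<^bold>\<rightarrow> \<psi>)"
    using MP.IH(2) by (elim exE conjE)
  have "(\<Delta> \<union> \<Delta>') \<turnstile>\<^sub>L\<^sub>V \<psi>"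
    by (rule LV.MP[OF LV_mono[OF 1(3)] LV_mono[OF 2(3)]]) simp_all
  with 1 2 show ?case by (intro exI[of _ "\<Delta> \<union> \<Delta>'"]) simp
next
  case (RCM \<phi> \<psi> \<Gamma> \<gamma>)
  then show ?case by (intro exI[of _ "{}"]) (simp add: LV.RCM)
qed

definition stone_space :: "'w topology \<Rightarrow> bool" where
  "stone_space X \<longleftrightarrow> compact_space X \<and> Hausdorff_space X \<and>
    (\<forall>C. connectedin X C \<longrightarrow> (\<exists>x. C \<subseteq> {x}))"

definition clopenin :: "'w topology \<Rightarrow> 'w set \<Rightarrow> bool" where
  "clopenin X A \<longleftrightarrow> openin X A \<and> closedin X A"

text \<open>For a clopen set \<open>A\<close>, \<open>closest \<sigma> x A\<close> is \<open>A \<inter> \<Inter>{U \<in> \<sigma> x. U \<inter> A \<noteq> {}}\<close>, where the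
  intersection of the empty family is taken to be empty: if no sphere around \<open>x\<close> meets \<open>A\<close>,
  there are no closest \<open>A\<close>-points. With this convention \<open>{x. closest \<sigma> x A \<subseteq> B}\<close> is the truth
  set of the counterfactual from \<open>A\<close> to \<open>B\<close> (lemma \<open>closest_subset_iff\<close>), hence truth sets of
  formulas are clopen (lemma \<open>truth_clopen\<close>). The Isabelle value \<open>\<Inter>{} = UNIV\<close> would not give
  this, as it makes the set \<open>A\<close> itself the value in the vacuous case; a topological sphere in the
  sense below satisfies the resulting condition too (lemma \<open>clopen_literal\<close>).\<close>

definition closest :: "('w \<Rightarrow> 'w set set) \<Rightarrow> 'w \<Rightarrow> 'w set \<Rightarrow> 'w set" where
  "closest \<sigma> x A = (if \<Union>(\<sigma> x) \<inter> A = {} then {} else A \<inter> \<Inter>{U \<in> \<sigma> x. U \<inter> A \<noteq> {}})"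

definition topological_sphere :: "'w topology \<Rightarrow> ('w \<Rightarrow> 'w set set) \<Rightarrow> bool" where
  "topological_sphere X \<sigma> \<longleftrightarrow>
     stone_space X \<and>
     (\<forall>x \<in> topspace X. \<sigma> x \<subseteq> Pow (topspace X) \<and> chain\<^sub>\<subseteq> (\<sigma> x)) \<and>
     (\<forall>A B. clopenin X A \<longrightarrow> clopenin X B \<longrightarrow>
        clopenin X {x \<in> topspace X. closest \<sigma> x A \<subseteq> B}) \<and>
     (\<forall>A. \<forall>x \<in> topspace X. clopenin X A \<longrightarrow> A \<inter> \<Union>(\<sigma> x) \<noteq> {} \<longrightarrow>
        (\<exists>U \<in> \<sigma> x. U \<inter> A \<noteq> {} \<and> (\<forall>V \<in> \<sigma> x. V \<inter> A \<noteq> {} \<longrightarrow> U \<subseteq> V))) \<and>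
     (\<forall>A. \<forall>x \<in> topspace X. clopenin X A \<longrightarrow> closedin X (closest \<sigma> x A))"

primrec truth :: "'w set \<Rightarrow> ('w \<Rightarrow> 'w set set) \<Rightarrow> ('v \<Rightarrow> 'w set) \<Rightarrow> 'v fm \<Rightarrow> 'w set" where
  "truth S \<sigma> v (Var p) = v p"
| "truth S \<sigma> v \<^bold>0 = {}"
| "truth S \<sigma> v \<^bold>1 = S"
| "truth S \<sigma> v (\<phi> \<^bold>\<and> \<psi>) = truth S \<sigma> v \<phi> \<inter> truth S \<sigma> v \<psi>"
| "truth S \<sigma> v (\<phi> \<^bold>\<or> \<psi>) = truth S \<sigma> v \<phi> \<union> truth S \<sigma> v \<psi>"
| "truth S \<sigma> v (\<phi> \<^bold>\<rightarrow> \<psi>) = (S - truth S \<sigma> v \<phi>) \<union> truth S \<sigma> v \<psi>"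
| "truth S \<sigma> v (\<phi> \<box>\<rightarrow> \<psi>) =
     {w \<in> S. \<Union>(\<sigma> w) \<inter> truth S \<sigma> v \<phi> = {} \<or>
        (\<exists>U \<in> \<sigma> w. U \<inter> truth S \<sigma> v \<phi> \<noteq> {} \<and> U \<inter> truth S \<sigma> v \<phi> \<subseteq> truth S \<sigma> v \<psi>)}"

definition LTS_model :: "'w topology \<Rightarrow> ('w \<Rightarrow> 'w set set) \<Rightarrow> ('v \<Rightarrow> 'w set) \<Rightarrow> bool" where
  "LTS_model X \<sigma> v \<longleftrightarrow> topological_sphere X \<sigma> \<and> (\<forall>p. clopenin X (v p))"

text \<open>A formula cannot quantify over all types of worlds, so the type is a parameter. The space
  of a model is any subset of the type.\<close>

definition LTS_conseq :: "'w itself \<Rightarrow> 'v fm set \<Rightarrow> 'v fm \<Rightarrow> bool" where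
  "LTS_conseq (_ :: 'w itself) \<Gamma> \<phi> \<longleftrightarrow>
     (\<forall>(X :: 'w topology) \<sigma> v. LTS_model X \<sigma> v \<longrightarrow>
        (\<forall>w \<in> topspace X.
           (\<forall>\<gamma> \<in> \<Gamma>. w \<in> truth (topspace X) \<sigma> v \<gamma>) \<longrightarrow> w \<in> truth (topspace X) \<sigma> v \<phi>))"

lemma closest_subset_iff:
  assumes "topological_sphere X \<sigma>" "clopenin X A" "x \<in> topspace X"
  shows "closest \<sigma> x A \<subseteq> B \<longleftrightarrow>
    \<Union>(\<sigma> x) \<inter> A = {} \<or> (\<exists>U \<in> \<sigma> x. U \<inter> A \<noteq> {} \<and> U \<inter> A \<subseteq> B)"
proof (cases "\<Union>(\<sigma> x) \<inter> A = {}")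
  case False
  have "A \<inter> \<Union>(\<sigma> x) \<noteq> {} \<longrightarrow>
      (\<exists>U \<in> \<sigma> x. U \<inter> A \<noteq> {} \<and> (\<forall>V \<in> \<sigma> x. V \<inter> A \<noteq> {} \<longrightarrow> U \<subseteq> V))"
    using assms unfolding topological_sphere_def by meson
  with False have "\<exists>U \<in> \<sigma> x. U \<inter> A \<noteq> {} \<and> (\<forall>V \<in> \<sigma> x. V \<inter> A \<noteq> {} \<longrightarrow> U \<subseteq> V)"
    by (simp only: Int_commute not_False_eq_True simp_thms)
  then obtain U where U: "U \<in> \<sigma> x" "U \<inter> A \<noteq> {}" "\<And>V. V \<in> \<sigma> x \<Longrightarrow> V \<inter> A \<noteq> {} \<Longrightarrow> U \<subseteq> V"
    by blast
  have "closest \<sigma> x A = A \<inter> \<Inter>{U \<in> \<sigma> x. U \<inter> A \<noteq> {}}"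
    using False by (simp only: closest_def if_False)
  also have "\<Inter>{U \<in> \<sigma> x. U \<inter> A \<noteq> {}} = U"
    using U by (intro antisym Inter_lower Inter_greatest) simp_all
  finally have "closest \<sigma> x A = U \<inter> A" by (simp only: Int_commute)
  then have "closest \<sigma> x A \<subseteq> B \<longleftrightarrow> U \<inter> A \<subseteq> B" by simp
  also have "\<dots> \<longleftrightarrow> (\<exists>U \<in> \<sigma> x. U \<inter> A \<noteq> {} \<and> U \<inter> A \<subseteq> B)"
    using U by blast
  finally show ?thesis using False by simp
qed (simp add: closest_def)

lemma truth_clopen:
  assumes "LTS_model X \<sigma> v"
  shows "clopenin X (truth (topspace X) \<sigma> v \<phi>)"
proof (induction \<phi>)
  case (Cf \<phi> \<psi>)
  have ts: "topological_sphere X \<sigma>" using assms by (simp add: LTS_model_def)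
  have "truth (topspace X) \<sigma> v (\<phi> \<box>\<rightarrow> \<psi>) = {x \<in> topspace X.
      closest \<sigma> x (truth (topspace X) \<sigma> v \<phi>) \<subseteq> truth (topspace X) \<sigma> v \<psi>}"
    by (simp add: closest_subset_iff[OF ts Cf(1)] cong: conj_cong)
  then show ?case using ts Cf by (simp add: topological_sphere_def)
qed (use assms in \<open>auto simp: LTS_model_def clopenin_def intro: openin_diff closedin_diff\<close>)

lemma clopen_literal:
  assumes ts: "topological_sphere X \<sigma>" and A: "clopenin X A" and B: "clopenin X B"
  shows "clopenin X {x \<in> topspace X. A \<inter> \<Inter>{U \<in> \<sigma> x. U \<inter> A \<noteq> {}} \<subseteq> B}"
proof (cases "A \<subseteq> B")
  case True
  then have "{x \<in> topspace X. A \<inter> \<Inter>{U \<in> \<sigma> x. U \<inter> A \<noteq> {}} \<subseteq> B} = topspace X" by auto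
  then show ?thesis by (simp add: clopenin_def)
next
  case False
  let ?T = "\<lambda>B. {x \<in> topspace X. closest \<sigma> x A \<subseteq> B}"
  have "A \<inter> \<Inter>{U \<in> \<sigma> x. U \<inter> A \<noteq> {}} \<subseteq> B \<longleftrightarrow> x \<in> ?T B - ?T {}" if "x \<in> topspace X" for x
  proof (cases "\<Union>(\<sigma> x) \<inter> A = {}")
    case True
    then have "{U \<in> \<sigma> x. U \<inter> A \<noteq> {}} = {}" by auto
    then have "A \<inter> \<Inter>{U \<in> \<sigma> x. U \<inter> A \<noteq> {}} = A" by (metis Inf_empty inf_top_right)
    then show ?thesis using True False that by (simp add: closest_def)
  next
    case F: False
    then have "\<not> closest \<sigma> x A \<subseteq> {}"
      using closest_subset_iff[OF ts A that, of "{}"] by blast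
    then show ?thesis using F that by (simp add: closest_def)
  qed
  then have "{x \<in> topspace X. A \<inter> \<Inter>{U \<in> \<sigma> x. U \<inter> A \<noteq> {}} \<subseteq> B} = ?T B - ?T {}" by auto
  moreover have "clopenin X {}" by (simp add: clopenin_def)
  then have "clopenin X (?T B)" "clopenin X (?T {})"
    using ts A B by (simp_all only: topological_sphere_def)
  ultimately show ?thesis by (simp add: clopenin_def openin_diff closedin_diff)
qed

end

theory Submission
  imports Defs
begin

text \<open>Soundness reduces to two laws for the closest points of a clopen set, which correspond to
  (L2) and (L3). Completeness is by a canonical model on the Stone space of maximal consistent
  sets. At a world \<open>w\<close>, the worlds containing every \<open>\<psi>\<close> with \<open>\<phi> \<box>\<rightarrow> \<psi>\<close> in \<open>w\<close> form a closed set
  \<open>f \<phi>\<close> of nearest \<open>\<phi>\<close>-worlds. By (L2) and (L3), \<open>f\<close> is a choice function on clopen sets that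
  satisfies Arrow's axiom: if \<open>A \<subseteq> C\<close> and \<open>f C\<close> meets \<open>A\<close>, then \<open>f A = f C \<inter> A\<close>. Consequently the
  unions of all \<open>f C\<close> with \<open>A \<subseteq> C\<close>, for the clopen sets \<open>A\<close> with \<open>f A\<close> nonempty, are nested, and
  the union belonging to \<open>A\<close> is the least one that meets \<open>A\<close> and meets it exactly in \<open>f A\<close>.\<close>

section \<open>Soundness\<close>

text \<open>The limit assumption turns the intersection in \<open>closest\<close> into one sphere,
  the least that meets \<open>A\<close>. The two laws below compare such least spheres.\<close>

lemma closest_cases:
  assumes "topological_sphere X \<sigma>" "clopenin X A" "x \<in> topspace X"
  obtains "\<Union>(\<sigma> x) \<inter> A = {}" "closest \<sigma> x A = {}"
  | U where "U \<in> \<sigma> x" "U \<inter> A \<noteq> {}" "\<And>V. V \<in> \<sigma> x \<Longrightarrow> V \<inter> A \<noteq> {} \<Longrightarrow> U \<subseteq> V"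
      "closest \<sigma> x A = U \<inter> A"
proof (cases "\<Union>(\<sigma> x) \<inter> A = {}")
  case True
  then show ?thesis using that(1) by (simp add: closest_def)
next
  case False
  then have "A \<inter> \<Union>(\<sigma> x) \<noteq> {}" by blast
  then have "\<exists>U \<in> \<sigma> x. U \<inter> A \<noteq> {} \<and> (\<forall>V \<in> \<sigma> x. V \<inter> A \<noteq> {} \<longrightarrow> U \<subseteq> V)"
    using assms unfolding topological_sphere_def by meson
  then obtain U where U: "U \<in> \<sigma> x" "U \<inter> A \<noteq> {}" "\<And>V. V \<in> \<sigma> x \<Longrightarrow> V \<inter> A \<noteq> {} \<Longrightarrow> U \<subseteq> V"
    by blast
  moreover have "\<Inter>{U \<in> \<sigma> x. U \<inter> A \<noteq> {}} = U"
    using U by (intro antisym Inter_lower Inter_greatest) simp_all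
  then have "closest \<sigma> x A = U \<inter> A" using False by (auto simp: closest_def)
  ultimately show ?thesis by (rule that(2))
qed

lemma closest_subset: "closest \<sigma> x A \<subseteq> A"
  by (auto simp: closest_def)

text \<open>This is (L2). If \<open>A\<close> has closest points, they lie in \<open>B\<close>, so
  the least sphere for \<open>A\<close> meets \<open>B\<close>, and conversely; minimality makes the
  two spheres equal.\<close>

lemma closest_eqI:
  assumes ts: "topological_sphere X \<sigma>" and x: "x \<in> topspace X"
    and A: "clopenin X A" and B: "clopenin X B"
    and AB: "closest \<sigma> x A \<subseteq> B" and BA: "closest \<sigma> x B \<subseteq> A"
  shows "closest \<sigma> x A = closest \<sigma> x B"
proof (rule closest_cases[OF ts A x])
  assume 1: "\<Union>(\<sigma> x) \<inter> A = {}" "closest \<sigma> x A = {}"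
  show ?thesis
    by (rule closest_cases[OF ts B x]) (use 1 BA in blast)+
next
  fix U assume U: "U \<in> \<sigma> x" "U \<inter> A \<noteq> {}" "\<And>V. V \<in> \<sigma> x \<Longrightarrow> V \<inter> A \<noteq> {} \<Longrightarrow> U \<subseteq> V"
    "closest \<sigma> x A = U \<inter> A"
  show ?thesis
  proof (rule closest_cases[OF ts B x])
    assume "\<Union>(\<sigma> x) \<inter> B = {}" "closest \<sigma> x B = {}"
    then show ?thesis using U AB by blast
  next
    fix V assume V: "V \<in> \<sigma> x" "V \<inter> B \<noteq> {}" "\<And>U. U \<in> \<sigma> x \<Longrightarrow> U \<inter> B \<noteq> {} \<Longrightarrow> V \<subseteq> U"
      "closest \<sigma> x B = V \<inter> B"
    have "U \<inter> B \<noteq> {}" "V \<inter> A \<noteq> {}" using U(2,4) V(2,4) AB BA by auto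
    then have "U = V" using U(1,3) V(1,3) by blast
    then show ?thesis using U(4) V(4) AB BA by blast
  qed
qed

text \<open>This is (L3). If the least sphere for \<open>A \<union> B\<close> misses
  \<open>A\<close> or \<open>B\<close>, one of the inclusions holds. Otherwise it is also least for
  each of them, since a sphere meeting either one meets the union.\<close>

lemma closest_Un:
  assumes ts: "topological_sphere X \<sigma>" and x: "x \<in> topspace X"
    and A: "clopenin X A" and B: "clopenin X B"
  shows "closest \<sigma> x (A \<union> B) \<subseteq> A \<or> closest \<sigma> x (A \<union> B) \<subseteq> B \<or>
    closest \<sigma> x (A \<union> B) = closest \<sigma> x A \<union> closest \<sigma> x B"
proof -
  have AB: "clopenin X (A \<union> B)" using A B by (auto simp: clopenin_def)
  show ?thesis
  proof (rule closest_cases[OF ts AB x])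
    fix U assume U: "U \<in> \<sigma> x" "U \<inter> (A \<union> B) \<noteq> {}"
      "\<And>V. V \<in> \<sigma> x \<Longrightarrow> V \<inter> (A \<union> B) \<noteq> {} \<Longrightarrow> U \<subseteq> V" "closest \<sigma> x (A \<union> B) = U \<inter> (A \<union> B)"
    show ?thesis
    proof (cases "U \<inter> A = {} \<or> U \<inter> B = {}")
      case True
      then show ?thesis using U(4) by blast
    next
      case False
      have "closest \<sigma> x C = U \<inter> C"
        if C: "clopenin X C" "C \<subseteq> A \<union> B" "U \<inter> C \<noteq> {}" for C
      proof (rule closest_cases[OF ts C(1) x])
        assume "\<Union>(\<sigma> x) \<inter> C = {}"
        then show ?thesis using U(1) C(3) by blast
      next
        fix V assume V: "V \<in> \<sigma> x" "V \<inter> C \<noteq> {}" "\<And>U. U \<in> \<sigma> x \<Longrightarrow> U \<inter> C \<noteq> {} \<Longrightarrow> V \<subseteq> U"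
          "closest \<sigma> x C = V \<inter> C"
        have "V \<inter> (A \<union> B) \<noteq> {}" using V(2) C(2) by blast
        then have "U = V" using U(1,3) V(1,3) C(3) by blast
        then show ?thesis using V(4) by simp
      qed
      then have "closest \<sigma> x A = U \<inter> A" "closest \<sigma> x B = U \<inter> B"
        using False A B by auto
      then show ?thesis using U(4) by blast
    qed
  qed simp
qed

text \<open>Soundness evaluates counterfactuals by this equivalence, so
  \<open>truth.simps(7)\<close> is deleted from the simpset below.\<close>

lemma truth_Cf_iff:
  assumes "LTS_model X \<sigma> v" "x \<in> topspace X"
  shows "x \<in> truth (topspace X) \<sigma> v (\<phi> \<box>\<rightarrow> \<psi>) \<longleftrightarrow>
    closest \<sigma> x (truth (topspace X) \<sigma> v \<phi>) \<subseteq> truth (topspace X) \<sigma> v \<psi>"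
proof -
  have "topological_sphere X \<sigma>" using assms(1) by (simp add: LTS_model_def)
  from closest_subset_iff[OF this truth_clopen[OF assms(1)] assms(2)] assms(2)
  show ?thesis by simp
qed

lemma LV_axiom_sound:
  assumes "LV_axiom \<phi>" and M: "LTS_model X \<sigma> v" and x: "x \<in> topspace X"
  shows "x \<in> truth (topspace X) \<sigma> v \<phi>"
proof -
  have ts: "topological_sphere X \<sigma>" using M by (simp add: LTS_model_def)
  note Cf = truth_Cf_iff[OF M x]
  note clopen = truth_clopen[OF M]
  from assms(1) show ?thesis
  proof cases
    case (L1 \<phi>)
    then show ?thesis using closest_subset Cf by fast
  next
    case (L2 \<phi> \<psi> \<gamma>)
    show ?thesis unfolding L2
      using closest_eqI[OF ts x clopen[of \<phi>] clopen[of \<psi>]] x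
      by (auto simp: Cf simp del: truth.simps(7))
  next
    case (L3 \<phi> \<psi> \<gamma>)
    show ?thesis unfolding L3
      using closest_Un[OF ts x clopen[of \<phi>] clopen[of \<psi>]] x
      by (auto simp: Cf simp del: truth.simps(7))
  next
    case (L4 \<phi> \<psi> \<gamma>)
    then show ?thesis using x by (auto simp: Cf simp del: truth.simps(7))
  qed (use x in auto)
qed

lemma LV_sound:
  assumes "\<Gamma> \<turnstile>\<^sub>L\<^sub>V \<phi>" and M: "LTS_model X \<sigma> v"
    and "x \<in> topspace X" and "\<And>\<gamma>. \<gamma> \<in> \<Gamma> \<Longrightarrow> x \<in> truth (topspace X) \<sigma> v \<gamma>"
  shows "x \<in> truth (topspace X) \<sigma> v \<phi>"
  using assms(1,3,4)
proof (induction arbitrary: x rule: LV.induct)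
  case (Ax \<phi> \<Gamma>)
  then show ?case by (simp add: LV_axiom_sound[OF _ M])
next
  case (RCM \<phi> \<psi> \<Gamma> \<gamma>)
  \<comment> \<open>The premise of the rule is a theorem, so its induction hypothesis holds at every
    world; this is why the induction generalises \<open>x\<close>.\<close>
  have "truth (topspace X) \<sigma> v \<phi> \<subseteq> truth (topspace X) \<sigma> v \<psi>"
    using RCM.IH truth_clopen[OF M, of \<phi>] by (auto simp: clopenin_def dest: openin_subset)
  then show ?case
    using RCM.prems(1) truth_Cf_iff[OF M RCM.prems(1)] by (auto simp del: truth.simps(7))
qed auto

section \<open>Maximal consistent sets\<close>

lemma LV_imp_refl: "\<Gamma> \<turnstile>\<^sub>L\<^sub>V (\<phi> \<^bold>\<rightarrow> \<phi>)"
  by (rule LV.MP[OF LV.Ax[OF LV_axiom.K[of \<phi> \<phi>]]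
        LV.MP[OF LV.Ax[OF LV_axiom.K[of \<phi> "\<phi> \<^bold>\<rightarrow> \<phi>"]] LV.Ax[OF LV_axiom.S]]])

lemma LV_weaken: "\<Gamma> \<turnstile>\<^sub>L\<^sub>V \<psi> \<Longrightarrow> \<Gamma> \<turnstile>\<^sub>L\<^sub>V (\<phi> \<^bold>\<rightarrow> \<psi>)"
  by (rule LV.MP[OF _ LV.Ax[OF LV_axiom.K]])

text \<open>RCM does not obstruct the deduction theorem: its premise is derived from the empty set,
  so its conclusion follows from any premises and only needs weakening.\<close>

lemma LV_deduction:
  assumes "insert \<phi> \<Gamma> \<turnstile>\<^sub>L\<^sub>V \<psi>"
  shows "\<Gamma> \<turnstile>\<^sub>L\<^sub>V (\<phi> \<^bold>\<rightarrow> \<psi>)"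
  using assms
proof (induction "insert \<phi> \<Gamma>" \<psi> rule: LV.induct)
  case (Prem \<psi>)
  then show ?case by (auto intro: LV_imp_refl LV_weaken LV.Prem)
next
  case (MP \<alpha> \<beta>)
  show ?case
    by (rule LV.MP[OF MP(2) LV.MP[OF MP(4) LV.Ax[OF LV_axiom.S]]])
qed (auto intro: LV_weaken LV.Ax LV.RCM)

definition mcs :: "'v fm set \<Rightarrow> bool" where
  "mcs w \<longleftrightarrow> (\<forall>\<phi>. w \<turnstile>\<^sub>L\<^sub>V \<phi> \<longrightarrow> \<phi> \<in> w) \<and> \<^bold>0 \<notin> w \<and> (\<forall>\<phi>. \<phi> \<in> w \<or> (\<phi> \<^bold>\<rightarrow> \<^bold>0) \<in> w)"

lemma mcs_closed: "mcs w \<Longrightarrow> w \<turnstile>\<^sub>L\<^sub>V \<phi> \<Longrightarrow> \<phi> \<in> w"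
  by (simp add: mcs_def)

lemma mcs_Bot: "mcs w \<Longrightarrow> \<^bold>0 \<notin> w"
  by (simp add: mcs_def)

lemma mcs_axiom: "mcs w \<Longrightarrow> LV_axiom \<phi> \<Longrightarrow> \<phi> \<in> w"
  by (blast intro: mcs_closed LV.Ax)

lemma mcs_MP: "mcs w \<Longrightarrow> (\<phi> \<^bold>\<rightarrow> \<psi>) \<in> w \<Longrightarrow> \<phi> \<in> w \<Longrightarrow> \<psi> \<in> w"
  by (blast intro: mcs_closed LV.MP LV.Prem)

lemma mcs_Top: "mcs w \<Longrightarrow> \<^bold>1 \<in> w"
  by (blast intro: mcs_axiom LV_axiom.TopI)

lemma mcs_Imp: assumes "mcs w" shows "(\<phi> \<^bold>\<rightarrow> \<psi>) \<in> w \<longleftrightarrow> (\<phi> \<in> w \<longrightarrow> \<psi> \<in> w)"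
proof
  assume "(\<phi> \<^bold>\<rightarrow> \<psi>) \<in> w"
  then show "\<phi> \<in> w \<longrightarrow> \<psi> \<in> w" using mcs_MP[OF assms] by blast
next
  assume imp: "\<phi> \<in> w \<longrightarrow> \<psi> \<in> w"
  show "(\<phi> \<^bold>\<rightarrow> \<psi>) \<in> w"
  proof (cases "\<psi> \<in> w")
    case True
    then show ?thesis by (blast intro: mcs_closed[OF assms] LV_weaken LV.Prem)
  next
    case False
    then have "(\<phi> \<^bold>\<rightarrow> \<^bold>0) \<in> w" using imp assms by (auto simp: mcs_def)
    then have "insert \<phi> w \<turnstile>\<^sub>L\<^sub>V \<^bold>0" by (blast intro: LV.MP LV.Prem)
    then have "insert \<phi> w \<turnstile>\<^sub>L\<^sub>V \<psi>" by (rule LV.MP[OF _ LV.Ax[OF LV_axiom.BotE]])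
    then show ?thesis by (intro mcs_closed[OF assms] LV_deduction)
  qed
qed

lemma mcs_And: assumes "mcs w" shows "(\<phi> \<^bold>\<and> \<psi>) \<in> w \<longleftrightarrow> \<phi> \<in> w \<and> \<psi> \<in> w"
  using mcs_axiom[OF assms LV_axiom.AndE1, of \<phi> \<psi>] mcs_axiom[OF assms LV_axiom.AndE2, of \<phi> \<psi>]
    mcs_axiom[OF assms LV_axiom.AndI, of \<phi> \<psi>]
  by (auto simp: mcs_Imp[OF assms])

lemma mcs_Or: assumes "mcs w" shows "(\<phi> \<^bold>\<or> \<psi>) \<in> w \<longleftrightarrow> \<phi> \<in> w \<or> \<psi> \<in> w"
  using mcs_axiom[OF assms LV_axiom.OrI1, of \<phi> \<psi>] mcs_axiom[OF assms LV_axiom.OrI2, of \<psi> \<phi>]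
    mcs_axiom[OF assms LV_axiom.OrE, of \<phi> "\<^bold>0" \<psi>]
  by (auto simp: mcs_Imp[OF assms] mcs_Bot[OF assms])

lemmas mcs_simps = mcs_Bot mcs_Top mcs_Imp mcs_And mcs_Or

lemma mcs_subset_eq:
  assumes "mcs v" "mcs w" "v \<subseteq> w"
  shows "v = w"
  using assms mcs_MP mcs_Bot unfolding mcs_def by blast

text \<open>Zorn's lemma gives a maximal set that does not derive \<open>\<phi>\<close>; unions of
  chains stay in \<open>P\<close> because a derivation uses finitely many premises.\<close>

lemma lindenbaum:
  assumes "\<not> \<Gamma> \<turnstile>\<^sub>L\<^sub>V \<phi>"
  obtains w where "mcs w" "\<Gamma> \<subseteq> w" "\<phi> \<notin> w"
proof -
  define P where "P = {\<Delta>. \<Gamma> \<subseteq> \<Delta> \<and> \<not> \<Delta> \<turnstile>\<^sub>L\<^sub>V \<phi>}"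
  have "\<exists>M\<in>P. \<forall>X\<in>P. M \<subseteq> X \<longrightarrow> X = M"
  proof (rule subset_Zorn_nonempty)
    show "P \<noteq> {}" using assms by (auto simp: P_def)
  next
    fix C assume C: "C \<noteq> {}" "subset.chain P C"
    have "\<not> \<Union>C \<turnstile>\<^sub>L\<^sub>V \<phi>"
    proof
      assume "\<Union>C \<turnstile>\<^sub>L\<^sub>V \<phi>"
      then obtain D where D: "D \<subseteq> \<Union>C" "finite D" "D \<turnstile>\<^sub>L\<^sub>V \<phi>"
        using LV_finitary by blast
      obtain B where B: "B \<in> C" "D \<subseteq> B"
        using finite_subset_Union_chain[OF D(2,1) C] by blast
      then have "B \<turnstile>\<^sub>L\<^sub>V \<phi>" using D LV_mono by blast
      moreover have "B \<in> P" using B C by (auto simp: subset.chain_def)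
      ultimately show False by (simp add: P_def)
    qed
    moreover have "\<Gamma> \<subseteq> \<Union>C" using C unfolding P_def subset.chain_def by blast
    ultimately show "\<Union>C \<in> P" by (simp add: P_def)
  qed
  then obtain w where w: "\<Gamma> \<subseteq> w" "\<not> w \<turnstile>\<^sub>L\<^sub>V \<phi>"
    and max: "\<And>\<Delta>. w \<subseteq> \<Delta> \<Longrightarrow> \<not> \<Delta> \<turnstile>\<^sub>L\<^sub>V \<phi> \<Longrightarrow> \<Delta> = w"
    by (auto simp: P_def)
  have ins: "(\<psi> \<^bold>\<rightarrow> \<phi>) \<in> w \<or> w \<turnstile>\<^sub>L\<^sub>V (\<psi> \<^bold>\<rightarrow> \<phi>)" if "\<psi> \<notin> w" for \<psi>
    using max[of "insert \<psi> w"] that LV_deduction by blast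
  have closed: "\<psi> \<in> w" if "w \<turnstile>\<^sub>L\<^sub>V \<psi>" for \<psi>
    using ins[of \<psi>] that w(2) by (blast intro: LV.MP LV.Prem)
  \<comment> \<open>Otherwise, by maximality, \<open>w\<close> derives \<open>\<phi>\<close> from
    \<open>\<psi>\<close> and also from its negation. The case split is carried out by refuting the
    negation of \<open>\<phi>\<close>; \<open>DNE\<close> then yields \<open>\<phi>\<close>.\<close>
  have "\<psi> \<in> w \<or> (\<psi> \<^bold>\<rightarrow> \<^bold>0) \<in> w" for \<psi>
  proof (rule ccontr)
    assume "\<not> ?thesis"
    then have 1: "w \<turnstile>\<^sub>L\<^sub>V (\<psi> \<^bold>\<rightarrow> \<phi>)" and 2: "w \<turnstile>\<^sub>L\<^sub>V ((\<psi> \<^bold>\<rightarrow> \<^bold>0) \<^bold>\<rightarrow> \<phi>)"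
      using ins LV.Prem by blast+
    let ?\<Delta> = "insert (\<phi> \<^bold>\<rightarrow> \<^bold>0) w"
    have n: "?\<Delta> \<turnstile>\<^sub>L\<^sub>V (\<phi> \<^bold>\<rightarrow> \<^bold>0)" by (simp add: LV.Prem)
    have "insert \<psi> ?\<Delta> \<turnstile>\<^sub>L\<^sub>V \<phi>"
      by (rule LV.MP[OF _ LV_mono[OF 1]]) (auto intro: LV.Prem)
    then have "insert \<psi> ?\<Delta> \<turnstile>\<^sub>L\<^sub>V \<^bold>0" by (rule LV.MP) (simp add: LV.Prem)
    then have "?\<Delta> \<turnstile>\<^sub>L\<^sub>V (\<psi> \<^bold>\<rightarrow> \<^bold>0)" by (rule LV_deduction)
    then have "?\<Delta> \<turnstile>\<^sub>L\<^sub>V \<phi>" by (rule LV.MP[OF _ LV_mono[OF 2]]) auto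
    then have "?\<Delta> \<turnstile>\<^sub>L\<^sub>V \<^bold>0" by (rule LV.MP[OF _ n])
    then have "w \<turnstile>\<^sub>L\<^sub>V ((\<phi> \<^bold>\<rightarrow> \<^bold>0) \<^bold>\<rightarrow> \<^bold>0)" by (rule LV_deduction)
    then have "w \<turnstile>\<^sub>L\<^sub>V \<phi>" by (rule LV.MP[OF _ LV.Ax[OF LV_axiom.DNE]])
    then show False using w(2) by simp
  qed
  moreover have "\<^bold>0 \<notin> w"
    using w(2) by (blast intro: LV.MP LV.Prem LV.Ax LV_axiom.BotE)
  ultimately have "mcs w" using closed by (auto simp: mcs_def)
  then show ?thesis using that w LV.Prem by blast
qed

text \<open>Derivability thus becomes a Boolean computation in maximal consistent sets, as for the
  tautology in \<open>Cf_closed\<close>.\<close>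

lemma LV_iff_mcs: "\<Gamma> \<turnstile>\<^sub>L\<^sub>V \<phi> \<longleftrightarrow> (\<forall>w. mcs w \<longrightarrow> \<Gamma> \<subseteq> w \<longrightarrow> \<phi> \<in> w)"
  by (meson LV_mono lindenbaum mcs_closed)

text \<open>The Stone map: these sets form the base of the topology below and turn out to be exactly
  its clopen sets.\<close>

definition ext :: "'v fm \<Rightarrow> 'v fm set set" where
  "ext \<phi> = {w. mcs w \<and> \<phi> \<in> w}"

lemma mem_ext: "w \<in> ext \<phi> \<longleftrightarrow> mcs w \<and> \<phi> \<in> w"
  by (simp add: ext_def)

lemma ext_simps:
  "ext \<^bold>0 = {}" "ext \<^bold>1 = Collect mcs"
  "ext (\<phi> \<^bold>\<and> \<psi>) = ext \<phi> \<inter> ext \<psi>" "ext (\<phi> \<^bold>\<or> \<psi>) = ext \<phi> \<union> ext \<psi>"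
  "ext (\<phi> \<^bold>\<rightarrow> \<psi>) = (Collect mcs - ext \<phi>) \<union> ext \<psi>"
  by (auto simp: mem_ext mcs_simps)

lemma ext_subset_iff: "ext \<phi> \<subseteq> ext \<psi> \<longleftrightarrow> {} \<turnstile>\<^sub>L\<^sub>V (\<phi> \<^bold>\<rightarrow> \<psi>)"
  by (auto simp: LV_iff_mcs mem_ext subset_iff mcs_simps)

section \<open>The canonical Stone space\<close>

definition canonical_topology :: "'v fm set topology" where
  "canonical_topology =
    topology (\<lambda>U. U \<subseteq> Collect mcs \<and> (\<forall>w\<in>U. \<exists>\<phi>. w \<in> ext \<phi> \<and> ext \<phi> \<subseteq> U))"

lemma openin_canonical:
  "openin canonical_topology U \<longleftrightarrow>
    U \<subseteq> Collect mcs \<and> (\<forall>w\<in>U. \<exists>\<phi>. w \<in> ext \<phi> \<and> ext \<phi> \<subseteq> U)"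
proof -
  let ?L = "\<lambda>U :: 'a fm set set. U \<subseteq> Collect mcs \<and> (\<forall>w\<in>U. \<exists>\<phi>. w \<in> ext \<phi> \<and> ext \<phi> \<subseteq> U)"
  have "istopology ?L"
    unfolding istopology_def
  proof (intro conjI allI impI)
    fix S T :: "'a fm set set" assume ST: "?L S" "?L T"
    show "S \<inter> T \<subseteq> Collect mcs" using ST by blast
    show "\<forall>w\<in>S \<inter> T. \<exists>\<phi>. w \<in> ext \<phi> \<and> ext \<phi> \<subseteq> S \<inter> T"
    proof
      fix w assume "w \<in> S \<inter> T"
      then obtain \<phi> \<psi> where "w \<in> ext \<phi>" "ext \<phi> \<subseteq> S" "w \<in> ext \<psi>" "ext \<psi> \<subseteq> T"
        using ST by (meson IntD1 IntD2)
      then show "\<exists>\<phi>. w \<in> ext \<phi> \<and> ext \<phi> \<subseteq> S \<inter> T"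
        by (intro exI[of _ "\<phi> \<^bold>\<and> \<psi>"]) (auto simp: ext_simps)
    qed
  next
    fix \<K> :: "'a fm set set set" assume \<K>: "\<forall>K\<in>\<K>. ?L K"
    show "\<Union>\<K> \<subseteq> Collect mcs" using \<K> by blast
    show "\<forall>w\<in>\<Union>\<K>. \<exists>\<phi>. w \<in> ext \<phi> \<and> ext \<phi> \<subseteq> \<Union>\<K>"
      using \<K> by (meson UnionE Union_upper subset_trans)
  qed
  then show ?thesis by (simp add: canonical_topology_def topology_inverse')
qed

lemma openin_ext: "openin canonical_topology (ext \<phi>)"
  by (auto simp: openin_canonical mem_ext)

lemma topspace_canonical: "topspace canonical_topology = Collect mcs"
proof
  show "topspace canonical_topology \<subseteq> Collect mcs"
    using openin_topspace openin_canonical by blast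
  show "Collect mcs \<subseteq> topspace canonical_topology"
    using openin_subset[OF openin_ext[of "\<^bold>1"]] by (simp add: ext_simps)
qed

lemma clopenin_ext: "clopenin canonical_topology (ext \<phi>)"
proof -
  have "topspace canonical_topology - ext \<phi> = ext (\<phi> \<^bold>\<rightarrow> \<^bold>0)"
    by (auto simp: topspace_canonical ext_simps)
  moreover have "ext \<phi> \<subseteq> topspace canonical_topology"
    by (rule openin_subset[OF openin_ext])
  ultimately show ?thesis by (simp add: clopenin_def closedin_def openin_ext)
qed

text \<open>Compactness is finitarity. \<open>N\<close> negates the formulas whose extension lies
  inside a member of the cover; a maximal consistent set including \<open>N\<close> would lie in no
  member, so \<open>N\<close> is inconsistent, and a finite inconsistent part yields the
  subcover.\<close>

lemma compact_space_canonical: "compact_space canonical_topology"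
  unfolding compact_space_alt
proof (intro allI impI)
  fix \<U> :: "'a fm set set set"
  assume "(\<forall>U\<in>\<U>. openin canonical_topology U) \<and> topspace canonical_topology \<subseteq> \<Union>\<U>"
  then have \<U>: "\<forall>U\<in>\<U>. openin canonical_topology U" "topspace canonical_topology \<subseteq> \<Union>\<U>"
    by simp_all
  define N where "N = {\<phi> \<^bold>\<rightarrow> \<^bold>0 | \<phi>. \<exists>U\<in>\<U>. ext \<phi> \<subseteq> U}"
  have "N \<turnstile>\<^sub>L\<^sub>V \<^bold>0"
  proof (rule ccontr)
    assume "\<not> N \<turnstile>\<^sub>L\<^sub>V \<^bold>0"
    then obtain w where w: "mcs w" "N \<subseteq> w" by (rule lindenbaum)
    then obtain U where "U \<in> \<U>" "w \<in> U" using \<U>(2) by (auto simp: topspace_canonical)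
    then obtain \<phi> where "w \<in> ext \<phi>" "ext \<phi> \<subseteq> U"
      using \<U>(1) by (meson openin_canonical)
    then have "\<phi> \<in> w" "(\<phi> \<^bold>\<rightarrow> \<^bold>0) \<in> w" using w(2) \<open>U \<in> \<U>\<close> by (auto simp: N_def mem_ext)
    then show False using w(1) by (simp add: mcs_simps)
  qed
  then obtain D where D: "D \<subseteq> N" "finite D" "D \<turnstile>\<^sub>L\<^sub>V \<^bold>0" using LV_finitary by blast
  have "\<forall>d\<in>D. \<exists>U\<in>\<U>. Collect mcs - ext d \<subseteq> U"
  proof
    fix d assume "d \<in> D"
    then obtain \<phi> U where "d = (\<phi> \<^bold>\<rightarrow> \<^bold>0)" "U \<in> \<U>" "ext \<phi> \<subseteq> U"
      using D(1) by (auto simp: N_def)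
    then show "\<exists>U\<in>\<U>. Collect mcs - ext d \<subseteq> U" by (intro bexI[of _ U]) (auto simp: ext_simps)
  qed
  then obtain u where u: "\<And>d. d \<in> D \<Longrightarrow> u d \<in> \<U>" "\<And>d. d \<in> D \<Longrightarrow> Collect mcs - ext d \<subseteq> u d"
    by metis
  have "Collect mcs \<subseteq> \<Union>(u ` D)"
  proof
    fix w :: "'a fm set" assume w: "w \<in> Collect mcs"
    then have "\<not> D \<subseteq> w" using D(3) LV_mono mcs_closed mcs_Bot by blast
    then obtain d where "d \<in> D" "d \<notin> w" by blast
    then show "w \<in> \<Union>(u ` D)" using u(2)[of d] w by (auto simp: mem_ext)
  qed
  then show "\<exists>\<F>. finite \<F> \<and> \<F> \<subseteq> \<U> \<and> topspace canonical_topology \<subseteq> \<Union>\<F>"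
    using D(2) u(1) by (intro exI[of _ "u ` D"]) (auto simp: topspace_canonical)
qed

lemma stone_space_canonical: "stone_space canonical_topology"
  unfolding stone_space_def
proof (intro conjI allI impI)
  show "compact_space canonical_topology" by (rule compact_space_canonical)
  \<comment> \<open>Separation by a basic set and its complement gives both the Hausdorff property
    and the triviality of connected sets.\<close>
  have sep: "\<exists>\<phi>. v \<in> ext \<phi> \<and> w \<in> ext (\<phi> \<^bold>\<rightarrow> \<^bold>0)"
    if vw: "mcs v" "mcs w" "v \<noteq> w" for v w :: "'a fm set"
  proof -
    obtain \<phi> where "\<phi> \<in> v" "\<phi> \<notin> w" using mcs_subset_eq[OF vw(1,2)] vw(3) by blast
    then show ?thesis using vw by (auto simp: mem_ext mcs_simps)
  qed
  show "Hausdorff_space (canonical_topology :: 'a fm set topology)"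
    unfolding Hausdorff_space_def
  proof (intro allI impI)
    fix v w :: "'a fm set"
    assume "v \<in> topspace canonical_topology \<and> w \<in> topspace canonical_topology \<and> v \<noteq> w"
    then obtain \<phi> where "v \<in> ext \<phi>" "w \<in> ext (\<phi> \<^bold>\<rightarrow> \<^bold>0)"
      using sep by (auto simp: topspace_canonical)
    then show "\<exists>U V. openin canonical_topology U \<and> openin canonical_topology V \<and>
        v \<in> U \<and> w \<in> V \<and> disjnt U V"
      using openin_ext[of \<phi>] openin_ext[of "\<phi> \<^bold>\<rightarrow> \<^bold>0"]
      by (intro exI[of _ "ext \<phi>"] exI[of _ "ext (\<phi> \<^bold>\<rightarrow> \<^bold>0)"]) (auto simp: disjnt_def ext_simps)
  qed
  fix C :: "'a fm set set" assume C: "connectedin canonical_topology C"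
  then have sub: "C \<subseteq> Collect mcs" using connectedin_subset_topspace topspace_canonical by blast
  have "v = w" if vw: "v \<in> C" "w \<in> C" for v w
  proof (rule ccontr)
    assume "v \<noteq> w"
    then obtain \<phi> where \<phi>: "v \<in> ext \<phi>" "w \<in> ext (\<phi> \<^bold>\<rightarrow> \<^bold>0)" using sep sub vw by blast
    have "C \<subseteq> ext \<phi> \<union> ext (\<phi> \<^bold>\<rightarrow> \<^bold>0)" using sub by (auto simp: ext_simps)
    moreover have "ext \<phi> \<inter> ext (\<phi> \<^bold>\<rightarrow> \<^bold>0) \<inter> C = {}" by (auto simp: ext_simps)
    moreover have "ext \<phi> \<inter> C \<noteq> {}" "ext (\<phi> \<^bold>\<rightarrow> \<^bold>0) \<inter> C \<noteq> {}" using \<phi> vw by blast+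
    ultimately show False
      using C openin_ext[of \<phi>] openin_ext[of "\<phi> \<^bold>\<rightarrow> \<^bold>0"] unfolding connectedin by blast
  qed
  then show "\<exists>x. C \<subseteq> {x}" by blast
qed

text \<open>The sphere conditions quantify over all clopen sets, the logic only over formulas. A
  clopen set is open and compact, hence a finite union of basic sets, which a disjunction
  expresses.\<close>

lemma clopenin_canonicalE:
  assumes "clopenin canonical_topology A"
  obtains \<phi> where "A = ext \<phi>"
proof -
  have "compactin canonical_topology A"
    using assms compact_space_canonical closedin_compact_space by (auto simp: clopenin_def)
  moreover have "\<And>U. U \<in> {ext \<phi> | \<phi>. ext \<phi> \<subseteq> A} \<Longrightarrow> openin canonical_topology U"
    using openin_ext by blast
  moreover have "A \<subseteq> \<Union>{ext \<phi> | \<phi>. ext \<phi> \<subseteq> A}"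
    using assms by (fastforce simp: clopenin_def openin_canonical)
  ultimately obtain F where F: "finite F" "F \<subseteq> {ext \<phi> | \<phi>. ext \<phi> \<subseteq> A}" "A \<subseteq> \<Union>F"
    unfolding compactin_def by (metis (no_types, lifting))
  have "\<exists>\<phi>. \<Union>F = ext \<phi>" using F(1,2)
  proof (induction F)
    case empty
    show ?case using ext_simps(1) by (metis Union_empty)
  next
    case (insert U F)
    then obtain \<phi> \<psi> where "\<Union>F = ext \<phi>" "U = ext \<psi>" by blast
    then show ?case by (intro exI[of _ "\<psi> \<^bold>\<or> \<phi>"]) (simp add: ext_simps)
  qed
  moreover have "\<Union>F = A" using F by blast
  ultimately show ?thesis using that by blast
qed

section \<open>The canonical sphere system\<close>

text \<open>For maximal consistent \<open>w\<close> this set is empty exactly if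
  \<open>\<phi> \<box>\<rightarrow> Bot\<close> is in \<open>w\<close>, the vacuous case.\<close>

definition nearest :: "'v fm set \<Rightarrow> 'v fm \<Rightarrow> 'v fm set set" where
  "nearest w \<phi> = {v. mcs v \<and> (\<forall>\<psi>. (\<phi> \<box>\<rightarrow> \<psi>) \<in> w \<longrightarrow> \<psi> \<in> v)}"

lemma Cf_mono:
  assumes "mcs w" "{} \<turnstile>\<^sub>L\<^sub>V (\<phi> \<^bold>\<rightarrow> \<psi>)" "(\<gamma> \<box>\<rightarrow> \<phi>) \<in> w"
  shows "(\<gamma> \<box>\<rightarrow> \<psi>) \<in> w"
  by (rule mcs_MP[OF assms(1) mcs_closed[OF assms(1) LV.RCM[OF assms(2)]] assms(3)])

lemma Cf_theorem:
  assumes "mcs w" "{} \<turnstile>\<^sub>L\<^sub>V \<psi>"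
  shows "(\<phi> \<box>\<rightarrow> \<psi>) \<in> w"
  by (rule Cf_mono[OF assms(1) LV_weaken[OF assms(2)] mcs_axiom[OF assms(1) LV_axiom.L1]])

text \<open>(L4) merges the two premises of modus ponens into one consequent, and RCM passes to the
  conclusion. Axioms and conclusions of RCM are theorems, which are consequents of every
  \<open>\<phi>\<close>.\<close>

lemma Cf_closed:
  assumes w: "mcs w" and "\<Delta> \<turnstile>\<^sub>L\<^sub>V \<psi>" and "\<And>\<theta>. \<theta> \<in> \<Delta> \<Longrightarrow> (\<phi> \<box>\<rightarrow> \<theta>) \<in> w"
  shows "(\<phi> \<box>\<rightarrow> \<psi>) \<in> w"
  using assms(2,3)
proof (induction rule: LV.induct)
  case (MP \<Delta> \<alpha> \<beta>)
  have "(\<phi> \<box>\<rightarrow> (\<alpha> \<^bold>\<and> (\<alpha> \<^bold>\<rightarrow> \<beta>))) \<in> w"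
    using mcs_axiom[OF w LV_axiom.L4, of \<phi> \<alpha> "\<alpha> \<^bold>\<rightarrow> \<beta>"] MP
    by (simp add: mcs_simps[OF w])
  moreover have "{} \<turnstile>\<^sub>L\<^sub>V ((\<alpha> \<^bold>\<and> (\<alpha> \<^bold>\<rightarrow> \<beta>)) \<^bold>\<rightarrow> \<beta>)"
    by (simp add: LV_iff_mcs mcs_simps)
  ultimately show ?case using Cf_mono[OF w] by blast
qed (auto intro: Cf_theorem[OF w] LV.Ax LV.RCM)

text \<open>No counterfactual is lost in passing from \<open>w\<close> to
  \<open>nearest w \<phi>\<close>: if \<open>\<psi>\<close> holds throughout, the consequents of
  \<open>\<phi>\<close> derive it by \<open>LV_iff_mcs\<close>, and they are closed under
  derivation.\<close>

lemma nearest_subset_iff: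
  assumes w: "mcs w"
  shows "nearest w \<phi> \<subseteq> ext \<psi> \<longleftrightarrow> (\<phi> \<box>\<rightarrow> \<psi>) \<in> w"
proof
  assume sub: "nearest w \<phi> \<subseteq> ext \<psi>"
  have "{\<theta>. (\<phi> \<box>\<rightarrow> \<theta>) \<in> w} \<turnstile>\<^sub>L\<^sub>V \<psi>"
    using sub by (auto simp: LV_iff_mcs nearest_def mem_ext)
  then show "(\<phi> \<box>\<rightarrow> \<psi>) \<in> w" by (rule Cf_closed[OF w]) simp
qed (auto simp: nearest_def mem_ext)

lemma nearest_subset: "mcs w \<Longrightarrow> nearest w \<phi> \<subseteq> ext \<phi>"
  by (simp add: nearest_subset_iff mcs_axiom LV_axiom.L1)

lemma nearest_alt:
  "mcs w \<Longrightarrow> nearest w \<phi> = {v. mcs v \<and> (\<forall>\<psi>. nearest w \<phi> \<subseteq> ext \<psi> \<longrightarrow> \<psi> \<in> v)}"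
  by (simp add: nearest_subset_iff) (simp add: nearest_def)

lemma nearest_eqI:
  assumes w: "mcs w" and "nearest w \<phi> \<subseteq> ext \<psi>" "nearest w \<psi> \<subseteq> ext \<phi>"
  shows "nearest w \<phi> = nearest w \<psi>"
proof -
  have "(\<phi> \<box>\<rightarrow> \<gamma>) \<in> w \<longleftrightarrow> (\<psi> \<box>\<rightarrow> \<gamma>) \<in> w" for \<gamma>
    using mcs_axiom[OF w LV_axiom.L2, of \<phi> \<psi> \<gamma>] assms(2,3)
    by (auto simp: mcs_simps[OF w] nearest_subset_iff[OF w])
  then show ?thesis by (simp add: nearest_def)
qed

lemma nearest_cong: "mcs w \<Longrightarrow> ext \<phi> = ext \<psi> \<Longrightarrow> nearest w \<phi> = nearest w \<psi>"
  using nearest_eqI nearest_subset by metis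

lemma nearest_Or:
  assumes w: "mcs w"
  shows "nearest w (\<phi> \<^bold>\<or> \<psi>) \<subseteq> ext \<phi> \<or> nearest w (\<phi> \<^bold>\<or> \<psi>) \<subseteq> ext \<psi> \<or>
    nearest w (\<phi> \<^bold>\<or> \<psi>) = nearest w \<phi> \<union> nearest w \<psi>"
proof -
  have "nearest w (\<phi> \<^bold>\<or> \<psi>) = nearest w \<phi> \<union> nearest w \<psi>"
    if "\<not> nearest w (\<phi> \<^bold>\<or> \<psi>) \<subseteq> ext \<phi>" "\<not> nearest w (\<phi> \<^bold>\<or> \<psi>) \<subseteq> ext \<psi>"
  proof -
    \<comment> \<open>The two excluded disjuncts of (L3) do not mention \<open>\<gamma>\<close>, so
      the third one holds for all \<open>\<gamma>\<close> at once.\<close>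
    have iff: "((\<phi> \<^bold>\<or> \<psi>) \<box>\<rightarrow> \<gamma>) \<in> w \<longleftrightarrow> (\<phi> \<box>\<rightarrow> \<gamma>) \<in> w \<and> (\<psi> \<box>\<rightarrow> \<gamma>) \<in> w" for \<gamma>
      using mcs_axiom[OF w LV_axiom.L3, of \<phi> \<psi> \<gamma>] that
      unfolding nearest_subset_iff[OF w] mcs_And[OF w] mcs_Or[OF w] mcs_Imp[OF w] by blast
    have "v \<in> nearest w \<phi> \<union> nearest w \<psi>" if v: "v \<in> nearest w (\<phi> \<^bold>\<or> \<psi>)" for v
    proof (rule ccontr)
      assume "v \<notin> nearest w \<phi> \<union> nearest w \<psi>"
      then obtain \<alpha> \<beta> where *: "(\<phi> \<box>\<rightarrow> \<alpha>) \<in> w" "\<alpha> \<notin> v" "(\<psi> \<box>\<rightarrow> \<beta>) \<in> w" "\<beta> \<notin> v"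
        using v by (auto simp: nearest_def)
      have "((\<phi> \<^bold>\<or> \<psi>) \<box>\<rightarrow> (\<alpha> \<^bold>\<or> \<beta>)) \<in> w"
        unfolding iff using *(1,3)
        by (auto intro: Cf_mono[OF w] LV.Ax LV_axiom.OrI1 LV_axiom.OrI2)
      then show False using v *(2,4) by (auto simp: nearest_def mcs_simps)
    qed
    moreover have "nearest w \<phi> \<union> nearest w \<psi> \<subseteq> nearest w (\<phi> \<^bold>\<or> \<psi>)"
      by (auto simp: nearest_def iff)
    ultimately show ?thesis by blast
  qed
  then show ?thesis by blast
qed

section \<open>Arrow's axiom for nearest worlds\<close>

lemma nearest_restrict:
  assumes w: "mcs w" and sub: "ext \<phi> \<subseteq> ext \<kappa>" and meet: "nearest w \<kappa> \<inter> ext \<phi> \<noteq> {}"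
  shows "nearest w \<phi> = nearest w \<kappa> \<inter> ext \<phi>"
proof -
  let ?\<psi> = "\<kappa> \<^bold>\<and> (\<phi> \<^bold>\<rightarrow> \<^bold>0)"
  have \<kappa>: "nearest w (\<phi> \<^bold>\<or> ?\<psi>) = nearest w \<kappa>"
    by (rule nearest_cong[OF w]) (use sub in \<open>auto simp: ext_simps mem_ext\<close>)
  txt \<open>Apply (L3) to the partition of \<open>ext \<kappa>\<close> into \<open>ext \<phi>\<close> and its complement.\<close>
  have disj: "ext \<phi> \<inter> ext ?\<psi> = {}" by (auto simp: ext_simps)
  \<comment> \<open>The third case of (L3) would place \<open>nearest w \<kappa>\<close> in the
    complement of \<open>ext \<phi>\<close>, against \<open>meet\<close>.\<close>
  consider "nearest w \<kappa> \<subseteq> ext \<phi>" | "nearest w \<kappa> = nearest w \<phi> \<union> nearest w ?\<psi>"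
    using nearest_Or[OF w, of \<phi> ?\<psi>] disj meet unfolding \<kappa> by blast
  then show ?thesis
  proof cases
    case 1
    then have "nearest w \<phi> = nearest w \<kappa>"
      using nearest_eqI[OF w] nearest_subset[OF w, of \<phi>] sub by blast
    then show ?thesis using 1 by blast
  next
    case 2
    then show ?thesis
      using nearest_subset[OF w, of \<phi>] nearest_subset[OF w, of ?\<psi>] disj by blast
  qed
qed

text \<open>If \<open>nearest w \<kappa>\<close> were empty, it would lie in
  \<open>ext \<phi>\<close> trivially, and (L2) would identify it with
  \<open>nearest w \<phi>\<close>.\<close>

lemma nearest_nonempty_mono:
  assumes w: "mcs w" and "ext \<phi> \<subseteq> ext \<kappa>" "nearest w \<phi> \<noteq> {}"
  shows "nearest w \<kappa> \<noteq> {}"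
proof
  assume "nearest w \<kappa> = {}"
  then have "nearest w \<phi> = nearest w \<kappa>"
    using nearest_eqI[OF w, of \<phi> \<kappa>] nearest_subset[OF w, of \<phi>] assms(2) by blast
  then show False using assms(3) \<open>nearest w \<kappa> = {}\<close> by simp
qed

section \<open>Spheres built from nearest worlds, and the limit assumption\<close>

definition sphere_of :: "'v fm set \<Rightarrow> 'v fm \<Rightarrow> 'v fm set set" where
  "sphere_of w \<phi> = \<Union>{nearest w \<kappa> | \<kappa>. ext \<phi> \<subseteq> ext \<kappa>}"

definition canonical_spheres :: "'v fm set \<Rightarrow> 'v fm set set set" where
  "canonical_spheres w = {sphere_of w \<phi> | \<phi>. nearest w \<phi> \<noteq> {}}"

text \<open>By Arrow's axiom each \<open>nearest w \<kappa>\<close> in the union either misses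
  \<open>ext \<phi>\<close> or cuts it in \<open>nearest w \<phi>\<close>; the choice
  \<open>\<kappa> = \<phi>\<close> contributes this set itself.\<close>

lemma sphere_of_Int_ext:
  assumes "mcs w"
  shows "sphere_of w \<phi> \<inter> ext \<phi> = nearest w \<phi>"
  using nearest_restrict[OF assms, of \<phi>] nearest_subset[OF assms, of \<phi>]
  unfolding sphere_of_def by blast

lemma nearest_nonempty_if_sphere_meets:
  assumes w: "mcs w" and "sphere_of w \<psi> \<inter> ext \<phi> \<noteq> {}"
  shows "nearest w \<phi> \<noteq> {}"
proof -
  obtain \<kappa> where "nearest w \<kappa> \<inter> ext \<phi> \<noteq> {}" using assms(2) by (auto simp: sphere_of_def)
  \<comment> \<open>Arrow's axiom needs a subset of \<open>ext \<kappa>\<close>, so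
    \<open>\<phi>\<close> is first cut down to its conjunction with \<open>\<kappa>\<close>.\<close>
  then have meet: "nearest w \<kappa> \<inter> ext (\<kappa> \<^bold>\<and> \<phi>) \<noteq> {}"
    using nearest_subset[OF w, of \<kappa>] by (auto simp: ext_simps)
  then have "nearest w (\<kappa> \<^bold>\<and> \<phi>) \<noteq> {}"
    using nearest_restrict[OF w _ meet] by (simp add: ext_simps)
  then show ?thesis by (rule nearest_nonempty_mono[OF w, rotated]) (simp add: ext_simps)
qed

lemma sphere_of_least:
  assumes w: "mcs w" and "sphere_of w \<psi> \<inter> ext \<phi> \<noteq> {}"
  shows "sphere_of w \<phi> \<subseteq> sphere_of w \<psi>"
proof
  fix x assume "x \<in> sphere_of w \<phi>"
  then obtain \<delta> where \<delta>: "ext \<phi> \<subseteq> ext \<delta>" "x \<in> nearest w \<delta>" by (auto simp: sphere_of_def)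
  obtain \<kappa> where \<kappa>: "ext \<psi> \<subseteq> ext \<kappa>" "nearest w \<kappa> \<inter> ext \<phi> \<noteq> {}"
    using assms(2) by (auto simp: sphere_of_def)
  \<comment> \<open>The disjunction compares the two choices. Its nearest worlds meet
    \<open>ext \<delta>\<close>: either they avoid \<open>ext \<kappa>\<close> entirely, or they
    include \<open>nearest w \<kappa>\<close>, which meets \<open>ext \<phi>\<close>. Arrow's axiom
    then puts \<open>x\<close> among them.\<close>
  let ?\<eta> = "\<kappa> \<^bold>\<or> \<delta>"
  have sub: "ext \<kappa> \<subseteq> ext ?\<eta>" "ext \<delta> \<subseteq> ext ?\<eta>" by (auto simp: ext_simps)
  have "nearest w ?\<eta> \<inter> ext \<delta> \<noteq> {}"
  proof (cases "nearest w ?\<eta> \<inter> ext \<kappa> = {}")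
    case True
    have "nearest w ?\<eta> \<noteq> {}" using nearest_nonempty_mono[OF w sub(2)] \<delta>(2) by blast
    then show ?thesis using True nearest_subset[OF w, of ?\<eta>] by (auto simp: ext_simps)
  next
    case False
    then show ?thesis using nearest_restrict[OF w sub(1)] \<kappa>(2) \<delta>(1) by blast
  qed
  then have "x \<in> nearest w ?\<eta>" using nearest_restrict[OF w sub(2)] \<delta>(2) by blast
  then show "x \<in> sphere_of w \<psi>" using \<kappa>(1) sub(1) by (auto simp: sphere_of_def)
qed

text \<open>The nearest worlds of the disjunction lie in both spheres, and one of them lies in
  \<open>ext \<phi>\<close> or in \<open>ext \<psi>\<close>. So one sphere meets the extension that
  generates the other, and leastness orders them.\<close>

lemma chain_canonical_spheres:
  assumes w: "mcs w"
  shows "chain\<^sub>\<subseteq> (canonical_spheres w)"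
  unfolding chain_subset_def
proof (intro ballI)
  fix U V assume "U \<in> canonical_spheres w" "V \<in> canonical_spheres w"
  then obtain \<phi> \<psi> where U: "U = sphere_of w \<phi>" and V: "V = sphere_of w \<psi>"
    and ne: "nearest w \<phi> \<noteq> {}" by (auto simp: canonical_spheres_def)
  have sub: "ext \<phi> \<subseteq> ext (\<phi> \<^bold>\<or> \<psi>)" "ext \<psi> \<subseteq> ext (\<phi> \<^bold>\<or> \<psi>)" by (auto simp: ext_simps)
  then have "nearest w (\<phi> \<^bold>\<or> \<psi>) \<subseteq> U" "nearest w (\<phi> \<^bold>\<or> \<psi>) \<subseteq> V"
    unfolding U V sphere_of_def by blast+
  moreover have "nearest w (\<phi> \<^bold>\<or> \<psi>) \<inter> ext \<phi> \<noteq> {} \<or> nearest w (\<phi> \<^bold>\<or> \<psi>) \<inter> ext \<psi> \<noteq> {}"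
    using nearest_nonempty_mono[OF w sub(1) ne] nearest_subset[OF w, of "\<phi> \<^bold>\<or> \<psi>"]
    by (auto simp: ext_simps)
  ultimately have "V \<inter> ext \<phi> \<noteq> {} \<or> U \<inter> ext \<psi> \<noteq> {}" by blast
  then show "U \<subseteq> V \<or> V \<subseteq> U" unfolding U V using sphere_of_least[OF w] by blast
qed

lemma canonical_spheres_least:
  assumes w: "mcs w" and "ext \<phi> \<inter> \<Union>(canonical_spheres w) \<noteq> {}"
  shows "sphere_of w \<phi> \<in> canonical_spheres w" "sphere_of w \<phi> \<inter> ext \<phi> \<noteq> {}"
    "\<And>V. V \<in> canonical_spheres w \<Longrightarrow> V \<inter> ext \<phi> \<noteq> {} \<Longrightarrow> sphere_of w \<phi> \<subseteq> V"
proof -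
  obtain \<psi> where "sphere_of w \<psi> \<inter> ext \<phi> \<noteq> {}"
    using assms(2) by (auto simp: canonical_spheres_def)
  then have ne: "nearest w \<phi> \<noteq> {}" by (rule nearest_nonempty_if_sphere_meets[OF w])
  then show "sphere_of w \<phi> \<in> canonical_spheres w" by (auto simp: canonical_spheres_def)
  show "sphere_of w \<phi> \<inter> ext \<phi> \<noteq> {}" using ne by (simp add: sphere_of_Int_ext[OF w])
  show "sphere_of w \<phi> \<subseteq> V" if "V \<in> canonical_spheres w" "V \<inter> ext \<phi> \<noteq> {}" for V
    using that sphere_of_least[OF w] by (auto simp: canonical_spheres_def)
qed

lemma closest_canonical:
  assumes w: "mcs w"
  shows "closest canonical_spheres w (ext \<phi>) = nearest w \<phi>"
proof (cases "\<Union>(canonical_spheres w) \<inter> ext \<phi> = {}")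
  case True
  \<comment> \<open>The default value of \<open>closest\<close> is right here: a nonempty
    \<open>nearest w \<phi>\<close> would itself give rise to a sphere that meets
    \<open>ext \<phi>\<close>.\<close>
  have "nearest w \<phi> = {}"
  proof (rule ccontr)
    assume "nearest w \<phi> \<noteq> {}"
    then have "sphere_of w \<phi> \<in> canonical_spheres w" "sphere_of w \<phi> \<inter> ext \<phi> \<noteq> {}"
      by (auto simp: canonical_spheres_def sphere_of_Int_ext[OF w])
    then show False using True by blast
  qed
  then show ?thesis using True by (simp add: closest_def)
next
  case False
  then have "ext \<phi> \<inter> \<Union>(canonical_spheres w) \<noteq> {}" by blast
  note least = canonical_spheres_least[OF w this]
  have "\<Inter>{U \<in> canonical_spheres w. U \<inter> ext \<phi> \<noteq> {}} = sphere_of w \<phi>"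
    using least by (intro antisym Inter_lower Inter_greatest) simp_all
  then show ?thesis using False by (simp add: closest_def Int_commute flip: sphere_of_Int_ext[OF w])
qed

lemma closedin_nearest:
  assumes "mcs w"
  shows "closedin canonical_topology (nearest w \<phi>)"
proof -
  have "nearest w \<phi> = \<Inter>{ext \<psi> | \<psi>. nearest w \<phi> \<subseteq> ext \<psi>}" (is "_ = \<Inter>?C")
  proof
    show "\<Inter>?C \<subseteq> nearest w \<phi>"
    proof
      fix v assume v: "v \<in> \<Inter>?C"
      have *: "v \<in> ext \<psi>" if "nearest w \<phi> \<subseteq> ext \<psi>" for \<psi> using v that by blast
      then have "mcs v" using nearest_subset[OF assms, of \<phi>] by (simp add: mem_ext)
      with * show "v \<in> nearest w \<phi>"
        by (subst nearest_alt[OF assms]) (simp add: mem_ext)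
    qed
  qed blast
  \<comment> \<open>\<open>closedin_Inter\<close> asks for a nonempty family;
    \<open>ext \<phi>\<close> belongs to it by \<open>nearest_subset\<close>.\<close>
  moreover have "closedin canonical_topology (\<Inter>?C)"
    using nearest_subset[OF assms] clopenin_ext
    by (intro closedin_Inter) (auto simp: clopenin_def)
  ultimately show ?thesis by simp
qed

text \<open>Once clopen sets are written as extensions, \<open>closest\<close> is
  \<open>nearest\<close>, and the set that must be clopen is the extension of a
  counterfactual.\<close>

lemma topological_sphere_canonical: "topological_sphere canonical_topology canonical_spheres"
  unfolding topological_sphere_def
proof (intro conjI allI ballI impI)
  fix w :: "'a fm set" assume "w \<in> topspace canonical_topology"
  then have w: "mcs w" by (simp add: topspace_canonical)
  show "canonical_spheres w \<subseteq> Pow (topspace canonical_topology)"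
    by (auto simp: canonical_spheres_def sphere_of_def topspace_canonical nearest_def)
  show "chain\<^sub>\<subseteq> (canonical_spheres w)" by (rule chain_canonical_spheres[OF w])
next
  fix A B :: "'a fm set set"
  assume "clopenin canonical_topology A" "clopenin canonical_topology B"
  then obtain \<phi> \<psi> where "A = ext \<phi>" "B = ext \<psi>" by (metis clopenin_canonicalE)
  then have "closest canonical_spheres x A \<subseteq> B \<longleftrightarrow> (\<phi> \<box>\<rightarrow> \<psi>) \<in> x" if "mcs x" for x
    using that by (simp add: closest_canonical nearest_subset_iff)
  then have "{x \<in> topspace canonical_topology. closest canonical_spheres x A \<subseteq> B}
      = ext (\<phi> \<box>\<rightarrow> \<psi>)"
    unfolding topspace_canonical ext_def by blast
  then show "clopenin canonical_topology
      {x \<in> topspace canonical_topology. closest canonical_spheres x A \<subseteq> B}"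
    by (simp add: clopenin_ext)
next
  fix A :: "'a fm set set" and w :: "'a fm set"
  assume "w \<in> topspace canonical_topology" "clopenin canonical_topology A"
    and ne: "A \<inter> \<Union>(canonical_spheres w) \<noteq> {}"
  then obtain \<phi> where w: "mcs w" and A: "A = ext \<phi>"
    by (metis clopenin_canonicalE topspace_canonical mem_Collect_eq)
  show "\<exists>U\<in>canonical_spheres w. U \<inter> A \<noteq> {} \<and>
      (\<forall>V\<in>canonical_spheres w. V \<inter> A \<noteq> {} \<longrightarrow> U \<subseteq> V)"
    using canonical_spheres_least[OF w ne[unfolded A]] unfolding A by blast
next
  fix A :: "'a fm set set" and w :: "'a fm set"
  assume "w \<in> topspace canonical_topology" "clopenin canonical_topology A"
  then show "closedin canonical_topology (closest canonical_spheres w A)"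
    by (metis clopenin_canonicalE topspace_canonical mem_Collect_eq closest_canonical closedin_nearest)
qed (rule stone_space_canonical)

section \<open>Truth lemma and completeness\<close>

lemma LTS_model_canonical:
  "LTS_model canonical_topology canonical_spheres (\<lambda>p. ext (Var p))"
  by (simp add: LTS_model_def topological_sphere_canonical clopenin_ext)

text \<open>The counterfactual step passes from truth to closest points, nearest worlds and
  membership by \<open>truth_Cf_iff\<close>, \<open>closest_canonical\<close> and
  \<open>nearest_subset_iff\<close>.\<close>

lemma truth_canonical:
  "truth (Collect mcs) canonical_spheres (\<lambda>p. ext (Var p)) \<phi> = ext \<phi>"
proof (induction \<phi>)
  case (Cf \<phi> \<psi>)
  let ?T = "truth (Collect mcs) canonical_spheres (\<lambda>p. ext (Var p))"
  have "w \<in> ?T (\<phi> \<box>\<rightarrow> \<psi>) \<longleftrightarrow> w \<in> ext (\<phi> \<box>\<rightarrow> \<psi>)" if w: "mcs w" for w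
    using truth_Cf_iff[OF LTS_model_canonical, of w \<phi> \<psi>] w
    unfolding topspace_canonical Cf by (simp add: closest_canonical nearest_subset_iff mem_ext)
  moreover have "?T (\<phi> \<box>\<rightarrow> \<psi>) \<subseteq> Collect mcs" by auto
  ultimately show ?case using mem_ext by blast
qed (auto simp: ext_simps)

text \<open>The canonical model has worlds of type \<open>'v fm set\<close>, so validity over that
  type alone already gives derivability; soundness is stated for an arbitrary type
  \<open>'w\<close>.\<close>

theorem theorem5p34:
  fixes \<Gamma> :: "'v fm set" and \<phi> :: "'v fm"
  shows "(\<Gamma> \<turnstile>\<^sub>L\<^sub>V \<phi> \<longleftrightarrow> LTS_conseq TYPE('v fm set) \<Gamma> \<phi>) \<and>
         (\<Gamma> \<turnstile>\<^sub>L\<^sub>V \<phi> \<longrightarrow> LTS_conseq TYPE('w) \<Gamma> \<phi>)"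
proof (intro conjI iffI impI)
  assume *: "LTS_conseq TYPE('v fm set) \<Gamma> \<phi>"
  have "\<phi> \<in> w" if "mcs w" "\<Gamma> \<subseteq> w" for w
    using *[unfolded LTS_conseq_def, rule_format, OF LTS_model_canonical, of w] that
    by (auto simp: truth_canonical topspace_canonical mem_ext)
  then show "\<Gamma> \<turnstile>\<^sub>L\<^sub>V \<phi>" by (simp add: LV_iff_mcs)
next
  assume "\<Gamma> \<turnstile>\<^sub>L\<^sub>V \<phi>"
  then show "LTS_conseq TYPE('v fm set) \<Gamma> \<phi>"
    using LV_sound by (force simp: LTS_conseq_def)
next
  assume "\<Gamma> \<turnstile>\<^sub>L\<^sub>V \<phi>"
  then show "LTS_conseq TYPE('w) \<Gamma> \<phi>"
    using LV_sound by (force simp: LTS_conseq_def)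
qed

end
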